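(* For every $n$, let $T$ be a random tournament on alternatives $x_1,\dots,x_n$ generated according to the generalized random model with probabilities $p_{i,j}$ satisfying $p_{i,j} \in \left[30\log n/n,\ 1 - 30\log n/n\right]$ for all $i\neq j$. Then with high probability (i.e., with probability tending to $1$ as $n\to\infty$), every alternative in $T$ is a $3$-king.
   Context: A tournament on a finite set $V$ of alternatives is a complete orientation: for every two distinct $x,y\in V$ exactly one of $x\succ y$ ("$x$ dominates $y$", an edge from $x$ to $y$) or $y\succ x$ holds. For an integer $k\ge 2$, an alternative $x$ is a $k$-king if for every other alternative $y$ there is a directed path from $x$ to $y$ of length (number of edges) at most $k$. Generalized random model: for each ordered pair $i\neq j$ there is a number $p_{i,j}\in[0,1]$ with $p_{i,j}+p_{j,i}=1$; independently for each unordered pair $\{i,j\}$, $x_i\succ x_j$ with probability $p_{i,j}$ and otherwise $x_j\succ x_i$. $\log$ is the natural logarithm. *)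

theory Defs
  imports "HOL-Probability.Probability" "Graph_Theory.Pair_Digraph"
begin

locale tournament = pair_digraph T for T :: "'a pair_pre_digraph" +
  assumes exactly_one_arc:
    "\<lbrakk>x \<in> pverts T; y \<in> pverts T; x \<noteq> y\<rbrakk> \<Longrightarrow> (x, y) \<in> parcs T \<longleftrightarrow> (y, x) \<notin> parcs T"

text \<open>
  A path is given by its list of arcs, so \<open>length q\<close> counts edges.
\<close>

definition k_king :: "nat \<Rightarrow> 'a pair_pre_digraph \<Rightarrow> 'a \<Rightarrow> bool" where
  "k_king k T x \<longleftrightarrow>
     x \<in> pverts T \<and>
     (\<forall>y \<in> pverts T - {x}. \<exists>q. pre_digraph.apath (with_proj T) x q y \<and> length q \<le> k)"

definition orientation_probs :: "nat \<Rightarrow> (nat \<Rightarrow> nat \<Rightarrow> real) \<Rightarrow> bool" where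
  "orientation_probs n p \<longleftrightarrow>
     (\<forall>i \<in> {1..n}. \<forall>j \<in> {1..n}. i \<noteq> j \<longrightarrow> p i j \<in> {0..1} \<and> p i j + p j i = 1)"

text \<open>
  The unordered pair of \<open>i\<close> and \<open>j\<close> with \<open>i < j\<close> is encoded as \<open>(i, j)\<close>. Its coin \<open>c (i, j)\<close>
  shows True with probability \<open>p i j\<close>; then \<open>i\<close> dominates \<open>j\<close>, otherwise \<open>j\<close> dominates \<open>i\<close>.
  By \<open>p i j + p j i = 1\<close> the choice of the order within the pair is immaterial, see
  \<open>prob_dominates\<close> below.
\<close>

definition unordered_pairs :: "nat \<Rightarrow> (nat \<times> nat) set" where
  "unordered_pairs n = {(i, j). 1 \<le> i \<and> i < j \<and> j \<le> n}"

definition tournament_of_coins :: "nat \<Rightarrow> (nat \<times> nat \<Rightarrow> bool) \<Rightarrow> nat pair_pre_digraph" where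
  "tournament_of_coins n c =
     \<lparr> pverts = {1..n},
       parcs = {(i, j). (i, j) \<in> unordered_pairs n \<and> c (i, j)} \<union>
               {(j, i). (i, j) \<in> unordered_pairs n \<and> \<not> c (i, j)} \<rparr>"

definition random_tournament :: "nat \<Rightarrow> (nat \<Rightarrow> nat \<Rightarrow> real) \<Rightarrow> nat pair_pre_digraph pmf" where
  "random_tournament n p =
     map_pmf (tournament_of_coins n)
       (Pi_pmf (unordered_pairs n) False (\<lambda>(i, j). bernoulli_pmf (p i j)))"

lemma pverts_tournament_of_coins [simp]: "pverts (tournament_of_coins n c) = {1..n}"
  by (simp add: tournament_of_coins_def)

lemma finite_unordered_pairs: "finite (unordered_pairs n)"
  by (rule finite_subset[of _ "{1..n} \<times> {1..n}"]) (auto simp: unordered_pairs_def)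

lemma tournament_of_coins: "tournament (tournament_of_coins n c)"
proof -
  have "parcs (tournament_of_coins n c) \<subseteq> {1..n} \<times> {1..n}"
    by (auto simp: tournament_of_coins_def unordered_pairs_def)
  then have "finite (parcs (tournament_of_coins n c))"
    by (rule finite_subset) simp
  then show ?thesis
    by unfold_locales (auto simp: tournament_of_coins_def unordered_pairs_def)
qed

lemma random_tournament_is_tournament:
  assumes "T \<in> set_pmf (random_tournament n p)"
  shows "tournament T" "pverts T = {1..n}"
  using assms by (auto simp: random_tournament_def tournament_of_coins)

lemma prob_dominates:
  assumes p: "orientation_probs n p" and ij: "i \<in> {1..n}" "j \<in> {1..n}" "i \<noteq> j"
  shows "measure_pmf.prob (random_tournament n p) {T. (i, j) \<in> parcs T} = p i j"
proof -
  let ?P = "Pi_pmf (unordered_pairs n) False (\<lambda>(i, j). bernoulli_pmf (p i j))"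
  have coin: "map_pmf (\<lambda>c. c (a, b)) ?P = bernoulli_pmf (p a b)"
    if "(a, b) \<in> unordered_pairs n" for a b
    using Pi_pmf_component[OF finite_unordered_pairs, of "(a, b)" n False
        "\<lambda>(i, j). bernoulli_pmf (p i j)"] that by simp
  have coin_prob: "measure_pmf.prob ?P {c. c (a, b) = v} = pmf (bernoulli_pmf (p a b)) v"
    if "(a, b) \<in> unordered_pairs n" for a b v
    unfolding coin[OF that, symmetric] pmf_map by (simp add: vimage_def)
  have pij: "0 \<le> p i j" "p i j \<le> 1" "0 \<le> p j i" "p j i \<le> 1" "p i j + p j i = 1"
    using p ij by (auto simp: orientation_probs_def)
  consider "i < j" | "j < i" using ij(3) by linarith
  then show ?thesis
  proof cases
    case 1
    then have "(i, j) \<in> unordered_pairs n" using ij by (simp add: unordered_pairs_def)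
    moreover from this 1 have "tournament_of_coins n -` {T. (i, j) \<in> parcs T} = {c. c (i, j) = True}"
      by (auto simp: tournament_of_coins_def unordered_pairs_def)
    ultimately show ?thesis
      using coin_prob[of i j True] pij by (simp add: random_tournament_def)
  next
    case 2
    then have "(j, i) \<in> unordered_pairs n" using ij by (simp add: unordered_pairs_def)
    moreover from this 2 have "tournament_of_coins n -` {T. (i, j) \<in> parcs T} = {c. c (j, i) = False}"
      by (auto simp: tournament_of_coins_def unordered_pairs_def)
    ultimately show ?thesis
      using coin_prob[of j i False] pij by (simp add: random_tournament_def)
  qed
qed

end

(* Fix x \<noteq> y, let V be the set of the other alternatives, and condition on the subtournament
   on V. Let A be the out-neighbours of x in V and B the in-neighbours of y in V. If y cannot be
   reached in three steps, then A and B are disjoint and every arc between them goes from B to A.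
   For fixed sets S = A \<union> B such splits form a chain, which is why this is unlikely: if every
   vertex misses A, and likewise B, with probability at most r, then such a configuration has
   probability at most (card V + 1) * r ^ card V. This follows by induction on V: if some v lies
   in A, then B avoids the out-neighbours of v and the configuration persists on its in-neighbours;
   symmetrically if v lies in B. Here r = 1 - 30 * ln n / n, and a union bound over the pairs (x, y)
   finishes the proof. *)
theory Submission
  imports Defs "HOL-Real_Asymp.Real_Asymp"
begin

section \<open>Events determined by few coordinates\<close>

text \<open>Stands in for measurability with respect to the coordinates in \<open>K\<close>: under a
  product pmf, events determined by disjoint sets of coordinates are independent.\<close>

definition determined_by :: "'i set \<Rightarrow> ('i \<Rightarrow> 'b) set \<Rightarrow> bool" where
  "determined_by K Q \<longleftrightarrow> (\<forall>c c'. (\<forall>i\<in>K. c i = c' i) \<longrightarrow> (c \<in> Q \<longleftrightarrow> c' \<in> Q))"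

lemma determined_byI:
  assumes "\<And>c c'. (\<And>i. i \<in> K \<Longrightarrow> c i = c' i) \<Longrightarrow> c \<in> Q \<longleftrightarrow> c' \<in> Q"
  shows "determined_by K Q"
  unfolding determined_by_def by (intro allI impI, rule assms) (rule bspec)

lemma determined_byD:
  assumes "determined_by K Q" "\<And>i. i \<in> K \<Longrightarrow> c i = c' i"
  shows "c \<in> Q \<longleftrightarrow> c' \<in> Q"
  using assms(1)[unfolded determined_by_def, rule_format, of c c'] assms(2) by blast

lemma determined_by_Int:
  assumes "determined_by K Q" "determined_by L R"
  shows "determined_by (K \<union> L) (Q \<inter> R)"
proof (rule determined_byI)
  fix c c' :: "'a \<Rightarrow> 'b"
  assume "\<And>i. i \<in> K \<union> L \<Longrightarrow> c i = c' i"
  then have "c \<in> Q \<longleftrightarrow> c' \<in> Q" "c \<in> R \<longleftrightarrow> c' \<in> R"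
    using determined_byD[OF assms(1), of c c'] determined_byD[OF assms(2), of c c'] by simp_all
  then show "c \<in> Q \<inter> R \<longleftrightarrow> c' \<in> Q \<inter> R" by simp
qed

lemma determined_by_Compl: "determined_by K Q \<Longrightarrow> determined_by K (- Q)"
  unfolding determined_by_def Compl_iff by blast

lemma determined_by_INT:
  assumes "\<And>w. w \<in> W \<Longrightarrow> determined_by (K w) (Q w)"
  shows "determined_by (\<Union>w\<in>W. K w) (\<Inter>w\<in>W. Q w)"
proof (rule determined_byI)
  fix c c' :: "'b \<Rightarrow> 'c"
  assume "\<And>i. i \<in> (\<Union>w\<in>W. K w) \<Longrightarrow> c i = c' i"
  then have "c \<in> Q w \<longleftrightarrow> c' \<in> Q w" if "w \<in> W" for w
    using that by (intro determined_byD[OF assms]) auto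
  then show "c \<in> (\<Inter>w\<in>W. Q w) \<longleftrightarrow> c' \<in> (\<Inter>w\<in>W. Q w)" by simp
qed

lemma prob_pair_pmf_Times:
  "measure_pmf.prob (pair_pmf M N) (A \<times> B) = measure_pmf.prob M A * measure_pmf.prob N B"
proof -
  \<comment> \<open>The product rule is applied to countable sets, so \<open>A\<close> and
    \<open>B\<close> are first cut down to the countable supports.\<close>
  have "measure_pmf.prob (pair_pmf M N) (A \<times> B) =
      measure_pmf.prob (pair_pmf M N) ((A \<times> B) \<inter> set_pmf (pair_pmf M N))"
    by (simp only: measure_Int_set_pmf)
  also have "(A \<times> B) \<inter> set_pmf (pair_pmf M N) = (A \<inter> set_pmf M) \<times> (B \<inter> set_pmf N)"
    by auto
  also have "measure_pmf.prob (pair_pmf M N) \<dots> =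
      measure_pmf.prob M (A \<inter> set_pmf M) * measure_pmf.prob N (B \<inter> set_pmf N)"
    by (rule measure_pmf_prob_product) (auto intro: countable_subset[OF Int_lower2])
  finally show ?thesis by (simp add: measure_Int_set_pmf)
qed

text \<open>The product pmf splits into independent factors over \<open>K\<close> and
  \<open>I - K\<close>; \<open>Q\<close> sees only the first and \<open>R\<close>, since
  \<open>L\<close> misses \<open>K\<close>, only the second.\<close>

lemma prob_Pi_pmf_Int:
  assumes "finite I" "determined_by K Q" "determined_by L R" "K \<subseteq> I" "L \<subseteq> I" "K \<inter> L = {}"
  shows "measure_pmf.prob (Pi_pmf I d P) (Q \<inter> R) =
         measure_pmf.prob (Pi_pmf I d P) Q * measure_pmf.prob (Pi_pmf I d P) R"
proof -
  let ?m = "\<lambda>(f, g) x. if x \<in> K then f x else g x"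
  let ?M = "Pi_pmf K d P" and ?N = "Pi_pmf (I - K) d P"
  have split: "Pi_pmf I d P = map_pmf ?m (pair_pmf ?M ?N)"
    using Pi_pmf_union[of K "I - K" d P] assms(1,4)
    by (simp add: finite_subset Un_absorb1)
  have Q: "?m (f, g) \<in> Q \<longleftrightarrow> f \<in> Q" for f g
    by (rule determined_byD[OF assms(2)]) auto
  have R: "?m (f, g) \<in> R \<longleftrightarrow> g \<in> R" for f g
    using assms(6) by (intro determined_byD[OF assms(3)]) auto
  have "?m -` (Q \<inter> R) = Q \<times> R" "?m -` Q = Q \<times> UNIV" "?m -` R = UNIV \<times> R"
    using Q R by (auto simp del: split_conv)
  then show ?thesis
    unfolding split by (simp add: prob_pair_pmf_Times)
qed

text \<open>The events \<open>C w\<close> are split off one at a time: the coordinates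
  \<open>K w\<close> meet neither \<open>L\<close> nor the other blocks, so \<open>C w\<close> is
  independent of the rest and costs a factor of at most \<open>r\<close>.\<close>

lemma prob_Pi_pmf_INT_le:
  assumes "finite I" "finite W"
    and "\<And>w. w \<in> W \<Longrightarrow> determined_by (K w) (C w)" "\<And>w. w \<in> W \<Longrightarrow> K w \<subseteq> I"
    and "\<And>w. w \<in> W \<Longrightarrow> K w \<inter> L = {}" "disjoint_family_on K W"
    and "determined_by L R" "L \<subseteq> I"
    and "\<And>w. w \<in> W \<Longrightarrow> measure_pmf.prob (Pi_pmf I d P) (C w) \<le> r"
  shows "measure_pmf.prob (Pi_pmf I d P) ((\<Inter>w\<in>W. C w) \<inter> R) \<le>
         r ^ card W * measure_pmf.prob (Pi_pmf I d P) R"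
  using assms(2-6,9)
proof (induction W rule: finite_induct)
  case (insert w W)
  let ?p = "measure_pmf.prob (Pi_pmf I d P)"
  let ?S = "(\<Inter>w\<in>W. C w) \<inter> R"
  have disj: "K w \<inter> K v = {}" if "v \<in> W" for v
    using insert.prems(4) insert.hyps(2) that unfolding disjoint_family_on_def by auto
  have "?p ((\<Inter>w\<in>insert w W. C w) \<inter> R) = ?p (C w \<inter> ?S)"
    by (simp add: Int_assoc)
  also have "\<dots> = ?p (C w) * ?p ?S"
  proof (rule prob_Pi_pmf_Int)
    show "determined_by ((\<Union>w\<in>W. K w) \<union> L) ?S"
      using insert.prems assms(7) by (intro determined_by_Int determined_by_INT) auto
    show "K w \<inter> ((\<Union>w\<in>W. K w) \<union> L) = {}"
      using disj insert.prems(3) by auto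
    show "determined_by (K w) (C w)" "K w \<subseteq> I" "(\<Union>w\<in>W. K w) \<union> L \<subseteq> I"
      using insert.prems(1,2) assms(8) by auto
  qed (rule assms(1))
  also have "\<dots> \<le> r * (r ^ card W * ?p R)"
  proof (rule mult_mono)
    have "disjoint_family_on K W"
      using insert.prems(4) by (rule disjoint_family_on_mono[rotated]) auto
    then show "?p ?S \<le> r ^ card W * ?p R"
      using insert.prems by (intro insert.IH) auto
    show "?p (C w) \<le> r" using insert.prems(5) by auto
    then show "0 \<le> r" using measure_nonneg order_trans by blast
  qed auto
  finally show ?case using insert.hyps by (simp add: mult.assoc)
qed simp

section \<open>Disjoint random sets without crossing arcs\<close>

text \<open>A random vertex set is encoded by its membership events: \<open>A u\<close> is the event
  that \<open>u\<close> belongs to the first set, \<open>B v\<close> that \<open>v\<close> belongs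
  to the second. The relation \<open>D\<close> is not random.\<close>

definition no_cross ::
  "('v \<Rightarrow> 'v \<Rightarrow> bool) \<Rightarrow> ('v \<Rightarrow> 'c set) \<Rightarrow> ('v \<Rightarrow> 'c set) \<Rightarrow> 'v set \<Rightarrow> 'c set" where
  "no_cross D A B V = {c. \<forall>u\<in>V. \<forall>v\<in>V. c \<in> A u \<longrightarrow> c \<in> B v \<longrightarrow> u \<noteq> v \<and> \<not> D u v}"

lemma determined_by_no_cross:
  fixes A B :: "'v \<Rightarrow> ('i \<Rightarrow> 'b) set"
  assumes "\<And>v. v \<in> V \<Longrightarrow> determined_by (K v) (A v)" "\<And>v. v \<in> V \<Longrightarrow> determined_by (K v) (B v)"
  shows "determined_by (\<Union>v\<in>V. K v) (no_cross D A B V)"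
proof (rule determined_byI)
  fix c c' :: "'i \<Rightarrow> 'b"
  assume "\<And>i. i \<in> (\<Union>v\<in>V. K v) \<Longrightarrow> c i = c' i"
  then have "c \<in> A v \<longleftrightarrow> c' \<in> A v" "c \<in> B v \<longleftrightarrow> c' \<in> B v" if "v \<in> V" for v
    using that determined_byD[OF assms(1)[OF that], of c c'] determined_byD[OF assms(2)[OF that], of c c']
    by auto
  then show "c \<in> no_cross D A B V \<longleftrightarrow> c' \<in> no_cross D A B V"
    by (simp add: no_cross_def)
qed

text \<open>
  The three summands are linear in \<open>k\<close>, and the extreme case is \<open>k = m\<close>.
\<close>

lemma three_case_bound:
  fixes a b z r :: real and k m :: nat
  assumes "1 \<le> k" "k \<le> m" "0 \<le> a" "0 \<le> b" "a + z \<le> r" "b + z \<le> r" "0 \<le> z"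
  shows "z * real m + a * real k + b * real (m + 1 - k) \<le> r * real (m + 1)"
proof -
  have 1: "real (m + 1 - k) = real m + 1 - real k"
    using assms by simp
  have k: "0 \<le> real k - 1" "0 \<le> real m - real k" using assms(1,2) by auto
  \<comment> \<open>The left side regroups as \<open>(a + z) * k + (b + z) * (m - k) + b\<close>,
    and the weights \<open>k\<close>, \<open>m - k\<close> and 1 add up to
    \<open>m + 1\<close>.\<close>
  have "(a + z) * real k \<le> r * real k" "(b + z) * (real m - real k) \<le> r * (real m - real k)" "b \<le> r"
    using assms k by (auto intro!: mult_right_mono)
  then show ?thesis
    unfolding 1 by (simp add: algebra_simps)
qed

text \<open>Removing a vertex \<open>v\<close> leaves three cases, each with
  \<open>card V - 1\<close> factors \<open>r\<close> from the other vertices; the last factor comes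
  from averaging over the status of \<open>v\<close>. The events \<open>A v\<close> and
  \<open>B v\<close> share the block \<open>K v\<close> and may be dependent: only the bounds on
  their complements enter.\<close>

lemma prob_no_cross_le:
  assumes "finite I" "finite V"
    and "\<And>v. v \<in> V \<Longrightarrow> determined_by (K v) (A v)" "\<And>v. v \<in> V \<Longrightarrow> determined_by (K v) (B v)"
    and "\<And>v. v \<in> V \<Longrightarrow> K v \<subseteq> I" "disjoint_family_on K V"
    and "\<And>v. v \<in> V \<Longrightarrow> measure_pmf.prob (Pi_pmf I d P) (- A v) \<le> r"
    and "\<And>v. v \<in> V \<Longrightarrow> measure_pmf.prob (Pi_pmf I d P) (- B v) \<le> r"
    and "\<And>u v. u \<in> V \<Longrightarrow> v \<in> V \<Longrightarrow> u \<noteq> v \<Longrightarrow> D u v \<or> D v u"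
  shows "measure_pmf.prob (Pi_pmf I d P) (no_cross D A B V) \<le> real (card V + 1) * r ^ card V"
  using assms(2-)
proof (induction V rule: finite_psubset_induct)
  case (psubset V)
  let ?p = "measure_pmf.prob (Pi_pmf I d P)"
  show ?case
  proof (cases "V = {}")
    case False
    then obtain v where v: "v \<in> V" by blast
    define V' where "V' = V - {v}"
    define N1 where "N1 = {u \<in> V'. D v u}"
    \<comment> \<open>Taken as a complement, so that \<open>N1\<close> and \<open>N2\<close>
      partition \<open>V'\<close> even where \<open>D\<close> holds in both directions; totality of
      \<open>D\<close> still gives an arc from each vertex of \<open>N2\<close> to
      \<open>v\<close>.\<close>
    define N2 where "N2 = V' - N1"
    define m where "m = card V"
    have r0: "0 \<le> r" using psubset.prems(5)[OF v] measure_nonneg order_trans by blast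
    have fin: "finite V'" "finite N1" "finite N2"
      using psubset.hyps by (auto simp: V'_def N1_def N2_def)
    have V': "V' \<subset> V" "card V' + 1 = m" "v \<notin> V'"
      using v psubset.hyps by (auto simp: V'_def m_def) (metis Suc_pred card_gt_0_iff empty_iff)
    have N: "N1 \<subseteq> V'" "N2 \<subseteq> V'" "N1 \<inter> N2 = {}" "N1 \<union> N2 = V'"
      by (auto simp: N1_def N2_def)
    have cardN: "card N1 + card N2 + 1 = m"
      using card_Un_disjoint[OF fin(2,3) N(3)] N(4) V'(2) by simp
    have IH: "?p (no_cross D A B X) \<le> real (card X + 1) * r ^ card X" if "X \<subseteq> V'" for X
    proof (rule psubset.IH)
      show X: "X \<subset> V" using that V'(1) by auto
      show "disjoint_family_on K X"
        using psubset.prems(4) X by (intro disjoint_family_on_mono[of X V]) auto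
    qed (rule psubset.prems; use that V'(1) in blast)+
    have Kdisj: "K u \<inter> K w = {}" if "u \<in> V" "w \<in> V" "u \<noteq> w" for u w
      using psubset.prems(4) that by (auto simp: disjoint_family_on_def)
    \<comment> \<open>Common form of the three cases: \<open>E\<close> decides the status of
      \<open>v\<close>, each \<open>C w\<close> keeps \<open>w\<close> out of one of the two sets,
      and the configuration persists on \<open>X\<close>. These parts use disjoint blocks of
      coordinates, so their probabilities multiply.\<close>
    have side: "?p (E \<inter> ((\<Inter>w\<in>W. C w) \<inter> no_cross D A B X)) \<le>
        ?p E * (real (card X + 1) * r ^ (card W + card X))"
      if W: "W \<union> X \<subseteq> V'" "W \<inter> X = {}"
        and C: "\<And>w. w \<in> W \<Longrightarrow> C w = - A w \<or> C w = - B w"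
        and E: "determined_by (K v) E" for E C W X
    proof -
      have detC: "determined_by (K w) (C w)" if "w \<in> W" for w
        using C[OF that] W(1) that V'(1) psubset.prems(1,2)
        by (metis determined_by_Compl subsetD psubset_imp_subset Un_iff)
      have detX: "determined_by (\<Union>v\<in>X. K v) (no_cross D A B X)"
        using W(1) V'(1) psubset.prems(1,2) by (intro determined_by_no_cross) blast+
      have sub: "W \<subseteq> V" "X \<subseteq> V" using W(1) V'(1) by auto
      have "?p (E \<inter> ((\<Inter>w\<in>W. C w) \<inter> no_cross D A B X)) =
          ?p E * ?p ((\<Inter>w\<in>W. C w) \<inter> no_cross D A B X)"
      proof (rule prob_Pi_pmf_Int[OF assms(1) E])
        show "determined_by ((\<Union>w\<in>W. K w) \<union> (\<Union>v\<in>X. K v)) ((\<Inter>w\<in>W. C w) \<inter> no_cross D A B X)"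
          by (intro determined_by_Int determined_by_INT detC detX)
        show "K v \<inter> ((\<Union>w\<in>W. K w) \<union> (\<Union>v\<in>X. K v)) = {}"
          using Kdisj[OF v] W(1) V'(3) sub by blast
      qed (use psubset.prems(3) v sub in blast)+
      also have "\<dots> \<le> ?p E * (r ^ card W * ?p (no_cross D A B X))"
      proof (intro mult_left_mono prob_Pi_pmf_INT_le[OF assms(1) _ detC _ _ _ detX])
        show "finite W" using W(1) fin(1) finite_subset by auto
        show "K w \<inter> (\<Union>v\<in>X. K v) = {}" if "w \<in> W" for w
          using Kdisj W(2) sub that by blast
        show "disjoint_family_on K W"
          using psubset.prems(4) sub(1) by (rule disjoint_family_on_mono[rotated])
        show "?p (C w) \<le> r" if "w \<in> W" for w
          using C[OF that] psubset.prems(5,6) sub that by auto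
      qed (use psubset.prems(3) sub in auto)
      also have "\<dots> \<le> ?p E * (r ^ card W * (real (card X + 1) * r ^ card X))"
        using IH[of X] W(1) r0 by (intro mult_left_mono) auto
      finally show ?thesis by (simp add: power_add mult_ac)
    qed
    have detv: "determined_by (K v) (- A v \<inter> - B v)" "determined_by (K v) (A v \<inter> - B v)"
        "determined_by (K v) (B v \<inter> - A v)"
      using psubset.prems(1,2)[OF v] determined_by_Int[of "K v" _ "K v"] determined_by_Compl
      by (metis sup.idem)+
    define z where "z = ?p (- A v \<inter> - B v)"
    define a where "a = ?p (A v \<inter> - B v)"
    define b where "b = ?p (B v \<inter> - A v)"
    \<comment> \<open>The complement of \<open>B v\<close> splits according to \<open>A v\<close>,
      and vice versa.\<close>
    have "a + z = ?p (- B v)" "b + z = ?p (- A v)"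
      unfolding a_def b_def z_def
      by (subst measure_pmf.finite_measure_Union[symmetric], auto intro!: arg_cong[where f = ?p])+
    then have abz: "a + z \<le> r" "b + z \<le> r"
      using psubset.prems(5,6)[OF v] by auto
    have nonneg: "0 \<le> a" "0 \<le> b" "0 \<le> z" by (auto simp: a_def b_def z_def)
    \<comment> \<open>The intersection over \<open>{}\<close> is the whole space; it gives the case
      of \<open>v\<close> in neither set the form of \<open>side\<close>.\<close>
    let ?E0 = "(- A v \<inter> - B v) \<inter> ((\<Inter>w\<in>{}. - A w) \<inter> no_cross D A B V')"
    let ?E1 = "(A v \<inter> - B v) \<inter> ((\<Inter>w\<in>N1. - B w) \<inter> no_cross D A B N2)"
    let ?E2 = "(B v \<inter> - A v) \<inter> ((\<Inter>w\<in>N2. - A w) \<inter> no_cross D A B N1)"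
    have D2: "D u v" if "u \<in> N2" for u
      using that psubset.prems(7)[of u v] v V' by (auto simp: N2_def N1_def)
    have D1: "D v u" if "u \<in> N1" for u
      using that by (auto simp: N1_def)
    \<comment> \<open>No fourth case arises: \<open>v\<close> in both sets is excluded by
      \<open>no_cross\<close> with both vertices equal to \<open>v\<close>.\<close>
    have "no_cross D A B V \<subseteq> ?E0 \<union> (?E1 \<union> ?E2)"
    proof
      fix c assume c: "c \<in> no_cross D A B V"
      have nc: "u \<noteq> w \<and> \<not> D u w" if "u \<in> V" "w \<in> V" "c \<in> A u" "c \<in> B w" for u w
        using c that by (auto simp: no_cross_def)
      have sub: "c \<in> no_cross D A B X" if "X \<subseteq> V'" for X
        using c that V'(1) unfolding no_cross_def by blast
      have NV: "N1 \<subseteq> V" "N2 \<subseteq> V" using N V'(1) by auto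
      show "c \<in> ?E0 \<union> (?E1 \<union> ?E2)"
      proof (cases "c \<in> A v")
        case True
        then have "c \<notin> B v" "\<And>w. w \<in> N1 \<Longrightarrow> c \<notin> B w"
          using nc[OF v v] nc[OF v] D1 NV by blast+
        then show ?thesis using True sub[OF N(2)] by auto
      next
        case A: False
        show ?thesis
        proof (cases "c \<in> B v")
          case True
          then have "\<And>w. w \<in> N2 \<Longrightarrow> c \<notin> A w"
            using nc[OF _ v] D2 NV by blast
          then show ?thesis using True A sub[OF N(1)] by auto
        next
          case False
          then show ?thesis using A sub[of V'] by auto
        qed
      qed
    qed
    then have "?p (no_cross D A B V) \<le> ?p (?E0 \<union> (?E1 \<union> ?E2))"
      by (intro measure_pmf.finite_measure_mono) auto
    also have "\<dots> \<le> ?p ?E0 + (?p ?E1 + ?p ?E2)"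
      by (rule order_trans[OF measure_Un_le add_left_mono[OF measure_Un_le]]) auto
    also have "\<dots> \<le> z * (real m * r ^ (m - 1)) +
        (a * (real (card N2 + 1) * r ^ (m - 1)) + b * (real (card N1 + 1) * r ^ (m - 1)))"
    proof -
      have e: "m = Suc (card V')" "m - 1 = card N1 + card N2" "m - 1 = card N2 + card N1"
        using V'(2) cardN by auto
      have "?p ?E0 \<le> z * (real m * r ^ (m - 1))"
        using side[of "{}" V' "\<lambda>w. - A w", OF _ _ _ detv(1)] unfolding e(1) z_def by simp
      moreover have "?p ?E1 \<le> a * (real (card N2 + 1) * r ^ (m - 1))"
        unfolding e(2) a_def by (rule side) (use detv N in auto)
      moreover have "?p ?E2 \<le> b * (real (card N1 + 1) * r ^ (m - 1))"
        unfolding e(3) b_def by (rule side) (use detv N in auto)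
      ultimately show ?thesis by linarith
    qed
    also have "\<dots> = (z * real m + a * real (card N2 + 1) + b * real (card N1 + 1)) * r ^ (m - 1)"
      by (simp add: algebra_simps)
    \<comment> \<open>Prepares \<open>three_case_bound\<close> with
      \<open>k = card N2 + 1\<close>.\<close>
    also have "card N1 + 1 = m + 1 - (card N2 + 1)"
      using cardN by simp
    also have "(z * real m + a * real (card N2 + 1) + b * real (m + 1 - (card N2 + 1))) * r ^ (m - 1)
        \<le> r * real (m + 1) * r ^ (m - 1)"
      using cardN abz nonneg r0 by (intro mult_right_mono three_case_bound) auto
    also have "\<dots> = real (m + 1) * r ^ m"
      using V'(2) by (cases m) auto
    finally show ?thesis unfolding m_def .
  qed (simp add: no_cross_def)
qed

section \<open>The random tournament\<close>

lemma parcs_tournament_of_coins_iff: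
  assumes "i \<in> {1..n}" "j \<in> {1..n}"
  shows "(i, j) \<in> parcs (tournament_of_coins n c) \<longleftrightarrow>
         i \<noteq> j \<and> (if i < j then c (i, j) else \<not> c (j, i))"
  using assms by (auto simp: tournament_of_coins_def unordered_pairs_def)

text \<open>An \<open>apath\<close> visits distinct vertices, hence the inequalities; for
  \<open>u = v\<close> the walk shortens to two arcs.\<close>

lemma apath_le_3I:
  assumes "x \<in> pverts T" "x \<noteq> y" "x \<noteq> u" "x \<noteq> v" "y \<noteq> u" "y \<noteq> v"
    and "(x, u) \<in> parcs T" "(v, y) \<in> parcs T" "u = v \<or> (u, v) \<in> parcs T"
  shows "\<exists>q. pre_digraph.apath (with_proj T) x q y \<and> length q \<le> 3"
proof (cases "u = v")
  case True
  then have "pre_digraph.apath (with_proj T) x [(x, u), (u, y)] y"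
    using assms by (auto simp: pre_digraph.apath_def pre_digraph.awalk_def
        pre_digraph.cas.simps pre_digraph.awalk_verts.simps)
  then show ?thesis by (intro exI[of _ "[(x, u), (u, y)]"]) auto
next
  case False
  then have "pre_digraph.apath (with_proj T) x [(x, u), (u, v), (v, y)] y"
    using assms by (auto simp: pre_digraph.apath_def pre_digraph.awalk_def
        pre_digraph.cas.simps pre_digraph.awalk_verts.simps)
  then show ?thesis by (intro exI[of _ "[(x, u), (u, v), (v, y)]"]) auto
qed

definition far :: "nat \<Rightarrow> nat \<Rightarrow> nat pair_pre_digraph set" where
  "far x y = {T. \<not> (\<exists>q. pre_digraph.apath (with_proj T) x q y \<and> length q \<le> 3)}"

text \<open>Conditioning on the arcs inside \<open>V\<close> becomes a sum over the disjoint events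
  \<open>G D\<close>. With \<open>D\<close> frozen, \<open>F D\<close> depends only on the arcs
  joining \<open>V\<close> to \<open>x\<close> and \<open>y\<close>, so it is independent of
  \<open>G D\<close>. The coin of the pair \<open>x\<close>, \<open>y\<close> is never inspected:
  ignoring a direct arc only enlarges the event being bounded.\<close>

lemma prob_far_le:
  assumes p: "orientation_probs n p"
    and r: "\<And>i j. i \<in> {1..n} \<Longrightarrow> j \<in> {1..n} \<Longrightarrow> i \<noteq> j \<Longrightarrow> 1 - r \<le> p i j"
    and xy: "x \<in> {1..n}" "y \<in> {1..n}" "x \<noteq> y"
  shows "measure_pmf.prob (random_tournament n p) (far x y) \<le> real (n - 1) * r ^ (n - 2)"
proof -
  define U where "U = unordered_pairs n"
  define M where "M = Pi_pmf U False (\<lambda>(i, j). bernoulli_pmf (p i j))"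
  let ?p = "measure_pmf.prob M"
  let ?T = "tournament_of_coins n"
  define V where "V = {1..n} - {x, y}"
  define A where "A v = {c. (x, v) \<in> parcs (?T c)}" for v
  define B where "B v = {c. (v, y) \<in> parcs (?T c)}" for v
  \<comment> \<open>The index of the coin that orients the pair \<open>i\<close>, \<open>j\<close>,
    in whichever order it is given.\<close>
  define e where "e i j = (min i j, max i j)" for i j :: nat
  \<comment> \<open>The two coins deciding \<open>A v\<close> and \<open>B v\<close>; for different
    \<open>v\<close> outside \<open>{x, y}\<close> these blocks are disjoint.\<close>
  define K where "K v = {e x v, e v y}" for v
  define F where "F = (\<lambda>D. no_cross (\<lambda>u v. (u, v) \<in> D) A B V)"
  define G where "G D = {c. parcs (?T c) \<inter> V \<times> V = D}" for D
  define b where "b = real (n - 1) * r ^ (n - 2)"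
  have finU: "finite U" by (simp add: U_def finite_unordered_pairs)
  have finV: "finite V" by (simp add: V_def)
  have "card V = n - 2" using xy by (simp add: V_def card_Diff_subset)
  \<comment> \<open>Two distinct alternatives force \<open>n\<close> to be at least 2, so the
    truncated subtractions are exact.\<close>
  then have cardV: "card V = n - 2" "card V + 1 = n - 1" using xy by auto
  have arc: "(i, j) \<in> parcs (?T c) \<longleftrightarrow> (if i < j then c (e i j) else \<not> c (e i j))"
    if "i \<in> {1..n}" "j \<in> {1..n}" "i \<noteq> j" for i j c
    using parcs_tournament_of_coins_iff[OF that(1,2)] that(3) by (auto simp: e_def)
  have prob_arc: "?p {c. (i, j) \<in> parcs (?T c)} = p i j"
    if "i \<in> {1..n}" "j \<in> {1..n}" "i \<noteq> j" for i j
    using prob_dominates[OF p that] by (simp add: random_tournament_def M_def U_def vimage_def)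
  have prob_no_arc: "?p (- {c. (i, j) \<in> parcs (?T c)}) \<le> r"
    if "i \<in> {1..n}" "j \<in> {1..n}" "i \<noteq> j" for i j
    using measure_pmf.prob_compl[of "{c. (i, j) \<in> parcs (?T c)}" M] prob_arc[OF that] r[OF that]
    by (simp add: Compl_eq_Diff_UNIV)
  have r0: "0 \<le> r" using prob_no_arc[OF xy] measure_nonneg order_trans by blast
  have VD: "v \<in> {1..n}" "v \<noteq> x" "v \<noteq> y" if "v \<in> V" for v using that by (auto simp: V_def)
  have detA: "determined_by (K v) (A v)" and detB: "determined_by (K v) (B v)" if "v \<in> V" for v
    using VD[OF that] xy by (auto simp: A_def B_def K_def arc intro!: determined_byI)
  have KU: "K v \<subseteq> U" if "v \<in> V" for v
    using VD[OF that] xy by (auto simp: K_def U_def unordered_pairs_def e_def min_def max_def)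
  have Kdisj: "disjoint_family_on K V"
    using xy by (auto simp: disjoint_family_on_def K_def V_def e_def min_def max_def split: if_splits)
  have detG: "determined_by (U \<inter> V \<times> V) (G D)" for D
  proof (rule determined_byI)
    fix c c' :: "nat \<times> nat \<Rightarrow> bool"
    assume eq: "\<And>i. i \<in> U \<inter> V \<times> V \<Longrightarrow> c i = c' i"
    have "parcs (?T c) \<inter> V \<times> V = parcs (?T c') \<inter> V \<times> V"
      using eq by (auto simp: tournament_of_coins_def U_def)
    then show "c \<in> G D \<longleftrightarrow> c' \<in> G D" by (simp add: G_def)
  qed
  have detF: "determined_by (\<Union>v\<in>V. K v) (F D)" for D
    unfolding F_def by (intro determined_by_no_cross detA detB)
  \<comment> \<open>If no coins realise \<open>D\<close>, both sides vanish; otherwise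
    \<open>D\<close> is the arc set of a tournament on \<open>V\<close>, which supplies the totality
    required by \<open>prob_no_cross_le\<close>.\<close>
  have each: "?p (G D \<inter> F D) \<le> b * ?p (G D)" for D
  proof (cases "G D = {}")
    case False
    then obtain c where D: "D = parcs (?T c) \<inter> V \<times> V" by (auto simp: G_def)
    have "?p (F D) \<le> real (card V + 1) * r ^ card V"
      unfolding F_def M_def
    proof (rule prob_no_cross_le[OF finU finV detA detB KU Kdisj])
      show "measure_pmf.prob (Pi_pmf U False (\<lambda>(i, j). bernoulli_pmf (p i j))) (- A v) \<le> r"
        "measure_pmf.prob (Pi_pmf U False (\<lambda>(i, j). bernoulli_pmf (p i j))) (- B v) \<le> r" if "v \<in> V" for v
        using prob_no_arc[of x v] prob_no_arc[of v y] VD[OF that] xy by (auto simp: A_def B_def M_def)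
      show "(u, v) \<in> D \<or> (v, u) \<in> D" if "u \<in> V" "v \<in> V" "u \<noteq> v" for u v
        using that VD[OF that(1)] VD[OF that(2)] arc[of u v c] arc[of v u c] unfolding D
        by (auto simp: e_def min_def max_def split: if_splits)
    qed
    then have "?p (F D) \<le> b" unfolding cardV(2) unfolding cardV(1) b_def .
    moreover have "?p (G D \<inter> F D) = ?p (G D) * ?p (F D)"
      unfolding M_def
    proof (rule prob_Pi_pmf_Int[OF finU detG detF])
      show "(\<Union>v\<in>V. K v) \<subseteq> U" using KU by auto
      show "U \<inter> V \<times> V \<inter> (\<Union>v\<in>V. K v) = {}"
        by (auto simp: K_def V_def e_def min_def max_def split: if_splits)
    qed auto
    ultimately show ?thesis
      by (simp add: mult.commute[of _ "?p (F D)"] mult_right_mono)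
  qed simp
  have finD: "finite (Pow (V \<times> V))" using finV by simp
  have "?T -` far x y \<subseteq> (\<Union>D\<in>Pow (V \<times> V). G D \<inter> F D)"
  proof
    fix c assume c: "c \<in> ?T -` far x y"
    define D where "D = parcs (?T c) \<inter> V \<times> V"
    have "c \<in> F D"
      unfolding F_def no_cross_def
    proof (intro CollectI ballI impI)
      fix u v assume uv: "u \<in> V" "v \<in> V" and AB: "c \<in> A u" "c \<in> B v"
      have "\<not> (u = v \<or> (u, v) \<in> parcs (?T c))"
        using c apath_le_3I[of x "?T c" y u v] VD[OF uv(1)] VD[OF uv(2)] xy AB
        by (auto simp: A_def B_def far_def)
      then show "u \<noteq> v \<and> (u, v) \<notin> D" by (auto simp: D_def)
    qed
    moreover have "c \<in> G D" "D \<in> Pow (V \<times> V)" by (auto simp: G_def D_def)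
    ultimately show "c \<in> (\<Union>D\<in>Pow (V \<times> V). G D \<inter> F D)" by blast
  qed
  then have "?p (?T -` far x y) \<le> ?p (\<Union>D\<in>Pow (V \<times> V). G D \<inter> F D)"
    by (intro measure_pmf.finite_measure_mono) auto
  also have "\<dots> \<le> (\<Sum>D\<in>Pow (V \<times> V). ?p (G D \<inter> F D))"
    using finD by (intro measure_pmf.finite_measure_subadditive_finite) auto
  also have "\<dots> \<le> (\<Sum>D\<in>Pow (V \<times> V). b * ?p (G D))"
    by (intro sum_mono each)
  \<comment> \<open>Different \<open>D\<close> give disjoint \<open>G D\<close>, so the sum over
    exponentially many \<open>D\<close> costs nothing.\<close>
  also have "\<dots> = b * ?p (\<Union>D\<in>Pow (V \<times> V). G D)"
    using finD
    by (subst measure_pmf.finite_measure_finite_Union)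
       (auto simp: sum_distrib_left disjoint_family_on_def G_def)
  also have "\<dots> \<le> b * 1"
    using r0 by (intro mult_left_mono) (auto simp: b_def)
  finally show ?thesis
    by (simp add: random_tournament_def M_def U_def b_def)
qed

text \<open>Union bound over at most \<open>n * n\<close> ordered pairs, each failing with
  probability at most \<open>n * r ^ (n - 2)\<close>.\<close>

lemma prob_all_3_kings_ge:
  assumes p: "orientation_probs n p" and "r \<ge> 0"
    and r: "\<And>i j. i \<in> {1..n} \<Longrightarrow> j \<in> {1..n} \<Longrightarrow> i \<noteq> j \<Longrightarrow> 1 - r \<le> p i j"
  shows "1 - real n ^ 3 * r ^ (n - 2) \<le>
    measure_pmf.prob (random_tournament n p) {T. \<forall>x \<in> pverts T. k_king 3 T x}"
proof -
  let ?R = "random_tournament n p"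
  let ?Q = "{T. \<forall>x \<in> pverts T. k_king 3 T x}"
  let ?X = "{(x, y). x \<in> {1..n} \<and> y \<in> {1..n} \<and> x \<noteq> y}"
  have sub: "?X \<subseteq> {1..n} \<times> {1..n}" by auto
  have finX: "finite ?X" by (rule finite_subset[OF sub]) simp
  have cardX: "card ?X \<le> n * n"
    using card_mono[OF _ sub] by simp
  \<comment> \<open>Restricting to the support makes the vertex set equal to \<open>{1..n}\<close>,
    so that a failure of \<open>k_king\<close> yields a pair in \<open>?X\<close>.\<close>
  have "- ?Q \<inter> set_pmf ?R \<subseteq> (\<Union>(x, y)\<in>?X. far x y)"
    using random_tournament_is_tournament(2)[of _ n p] by (fastforce simp: k_king_def far_def)
  then have "measure_pmf.prob ?R (- ?Q \<inter> set_pmf ?R) \<le> measure_pmf.prob ?R (\<Union>(x, y)\<in>?X. far x y)"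
    by (intro measure_pmf.finite_measure_mono) auto
  also have "\<dots> \<le> (\<Sum>(x, y)\<in>?X. measure_pmf.prob ?R (far x y))"
    using measure_pmf.finite_measure_subadditive_finite[OF finX, of "\<lambda>(x, y). far x y" ?R]
    by (simp add: case_prod_unfold)
  also have "\<dots> \<le> (\<Sum>(x, y)\<in>?X. real (n - 1) * r ^ (n - 2))"
    using prob_far_le[OF p r] by (intro sum_mono) auto
  also have "\<dots> = real (card ?X) * (real (n - 1) * r ^ (n - 2))"
    by (simp only: case_prod_unfold sum_constant)
  also have "\<dots> \<le> real (n * n) * (real n * r ^ (n - 2))"
    using cardX \<open>r \<ge> 0\<close>
    by (intro mult_mono mult_right_mono iffD2[OF of_nat_le_iff]) auto
  finally have "measure_pmf.prob ?R (- ?Q) \<le> real n ^ 3 * r ^ (n - 2)"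
    by (simp add: measure_Int_set_pmf power3_eq_cube mult_ac)
  moreover have "measure_pmf.prob ?R (- ?Q) = 1 - measure_pmf.prob ?R ?Q"
    using measure_pmf.prob_compl[of ?Q ?R] by (simp add: Compl_eq_Diff_UNIV)
  ultimately show ?thesis by linarith
qed

text \<open>For small \<open>n\<close> above 1 the interval is empty, so the bounds are demanded
  only from some \<open>n\<close> on.\<close>

theorem theorem1:
  fixes p :: "nat \<Rightarrow> nat \<Rightarrow> nat \<Rightarrow> real"
  assumes "\<And>n. orientation_probs n (p n)"
    and "\<forall>\<^sub>F n in sequentially. \<forall>i \<in> {1..n}. \<forall>j \<in> {1..n}. i \<noteq> j \<longrightarrow>
           p n i j \<in> {30 * ln (real n) / real n .. 1 - 30 * ln (real n) / real n}"
  shows "(\<lambda>n. measure_pmf.prob (random_tournament n (p n))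
               {T. \<forall>x \<in> pverts T. k_king 3 T x}) \<longlonglongrightarrow> 1"
proof (rule tendsto_sandwich)
  let ?q = "\<lambda>n. 30 * ln (real n) / real n"
  \<comment> \<open>Comes from \<open>r = 1 - ?q n\<close> and 1 - t <= exp (- t). As
    \<open>?q n * (n - 2)\<close> is 30 ln n up to a vanishing term, the error is of order
    n^(-27).\<close>
  let ?f = "\<lambda>n. 1 - real n ^ 3 * exp (- ?q n * (real n - 2))"
  show "?f \<longlonglongrightarrow> 1" by real_asymp
  \<comment> \<open>Makes \<open>1 - ?q n\<close> nonnegative, as needed both for \<open>r\<close>
    and for raising 1 - t <= exp (- t) to a power.\<close>
  have small: "\<forall>\<^sub>F n in sequentially. ?q n \<le> 1" by real_asymp
  show "\<forall>\<^sub>F n in sequentially. ?f n \<le>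
      measure_pmf.prob (random_tournament n (p n)) {T. \<forall>x \<in> pverts T. k_king 3 T x}"
    using assms(2) small eventually_ge_at_top[of 2]
  proof eventually_elim
    case (elim n)
    have "(1 - ?q n) ^ (n - 2) \<le> exp (- ?q n) ^ (n - 2)"
      using elim(2) exp_ge_add_one_self[of "- ?q n"] by (intro power_mono) auto
    also have "\<dots> = exp (- ?q n * (real n - 2))"
      using elim(3) by (simp add: exp_of_nat_mult[symmetric] mult_ac)
    finally have "?f n \<le> 1 - real n ^ 3 * (1 - ?q n) ^ (n - 2)"
      by (simp add: mult_left_mono)
    also have "\<dots> \<le> measure_pmf.prob (random_tournament n (p n)) {T. \<forall>x \<in> pverts T. k_king 3 T x}"
      using elim(1,2) by (intro prob_all_3_kings_ge assms(1)) auto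
    finally show ?case .
  qed
qed auto

end
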